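(* (i) Let $(X,\preceq)$ be a Debreu separable preorder and $I$ a finite set. Then $(X,\preceq)$ has a multi-utility $(u_i)_{i \in I}$ if and only if it has a strict monotone multi-utility $(v_i)_{i \in I}$. (ii) There exist partial orders that have finite multi-utilities and whose smallest strict monotone multi-utility is countably infinite. In particular, such partial orders exist that have a multi-utility of cardinality $2$.
   Context: A preorder $\preceq$ on $X$ is a reflexive transitive relation; $x\prec y$ means $x\preceq y$ and not $y\preceq x$. $(X,\preceq)$ is Debreu separable if there is a countable $D\subseteq X$ such that whenever $x\prec y$ there is $d\in D$ with $x\preceq d\preceq y$. A multi-utility is a family $(u_i)_{i\in I}$ of functions $u_i:X\to\mathbb{R}$ with $x\preceq y$ iff $u_i(x)\le u_i(y)$ for all $i\in I$. A strict monotone is a function $v:X\to\mathbb{R}$ with $x\preceq y\Rightarrow v(x)\le v(y)$ and $x\prec y\Rightarrow v(x)<v(y)$; a strict monotone multi-utility is a multi-utility consisting of strict monotones. *)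

theory Defs
  imports Complex_Main "HOL-Library.Countable_Set" "HOL-Library.Equipollence"
begin

definition strict_in :: "('a \<times> 'a) set \<Rightarrow> 'a \<Rightarrow> 'a \<Rightarrow> bool" where
  "strict_in r x y \<longleftrightarrow> (x, y) \<in> r \<and> (y, x) \<notin> r"

definition debreu_separable :: "'a set \<Rightarrow> ('a \<times> 'a) set \<Rightarrow> bool" where
  "debreu_separable X r \<longleftrightarrow>
     (\<exists>D. D \<subseteq> X \<and> countable D \<and>
        (\<forall>x\<in>X. \<forall>y\<in>X. strict_in r x y \<longrightarrow> (\<exists>d\<in>D. (x, d) \<in> r \<and> (d, y) \<in> r)))"

definition multi_utility ::
    "'a set \<Rightarrow> ('a \<times> 'a) set \<Rightarrow> 'i set \<Rightarrow> ('i \<Rightarrow> 'a \<Rightarrow> real) \<Rightarrow> bool" where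
  "multi_utility X r I u \<longleftrightarrow>
     (\<forall>x\<in>X. \<forall>y\<in>X. (x, y) \<in> r \<longleftrightarrow> (\<forall>i\<in>I. u i x \<le> u i y))"

definition strict_monotone :: "'a set \<Rightarrow> ('a \<times> 'a) set \<Rightarrow> ('a \<Rightarrow> real) \<Rightarrow> bool" where
  "strict_monotone X r v \<longleftrightarrow>
     (\<forall>x\<in>X. \<forall>y\<in>X. ((x, y) \<in> r \<longrightarrow> v x \<le> v y) \<and> (strict_in r x y \<longrightarrow> v x < v y))"

definition strict_monotone_multi_utility ::
    "'a set \<Rightarrow> ('a \<times> 'a) set \<Rightarrow> 'i set \<Rightarrow> ('i \<Rightarrow> 'a \<Rightarrow> real) \<Rightarrow> bool" where
  "strict_monotone_multi_utility X r I v \<longleftrightarrow>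
     multi_utility X r I v \<and> (\<forall>i\<in>I. strict_monotone X r (v i))"

text \<open>
  The cardinality of a multi-utility is that of its index set. Index sets are drawn from the type
  of real-valued functions on the ground type: up to repetition of members, every family of such
  functions can be indexed by its own members, so no multi-utility is lost in the minimization.
\<close>
definition smallest_strict_monotone_multi_utility_countably_infinite ::
    "'a set \<Rightarrow> ('a \<times> 'a) set \<Rightarrow> bool" where
  "smallest_strict_monotone_multi_utility_countably_infinite X r \<longleftrightarrow>
     (\<exists>(I :: ('a \<Rightarrow> real) set) v.
        strict_monotone_multi_utility X r I v \<and> I \<approx> (UNIV :: nat set) \<and>
        (\<forall>(J :: ('a \<Rightarrow> real) set) w. strict_monotone_multi_utility X r J w \<longrightarrow> I \<lesssim> J))"

end

theory Submission
  imports Defs "HOL-Analysis.Continuum_Not_Denumerable" "HOL-Analysis.Finite_Cartesian_Product"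
begin

text \<open>
  (i) If x is strictly below y but u i x = u i y, then a separating d also has the value u i d = u i x, so
  u i fails to be strict on only countably many level sets. Open a gap at each of these values (with
  summable lengths) and order the level set inside the gap by the sum of the finitely many utilities,
  which is a strict monotone. This keeps every strict inequality of u i, hence the multi-utility.

  (ii) The product order on the plane has the coordinates as a multi-utility, and the combinations
  m x + y and x + m y with m > 0 form a countable strict monotone one. Suppose a finite family were
  a strict monotone multi-utility. Each member v jumps from (x, 0) to (x, 1), and for x < x' some
  member separates (x, 1) from (x', 0), so that its jumps at x and x' are disjoint. Choosing a
  rational in every jump gives an injection of the reals into a finite power of the rationals.
\<close>

section \<open>Opening gaps at countably many values\<close>

text \<open>Summed over n, this is the total length of the gaps opened below t, plus the fraction q
  of the gaps at t itself. An enumeration c that repeats a value only widens the gap there; the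
  total stays bounded by the geometric series.\<close>

definition gap_weight :: "(nat \<Rightarrow> real) \<Rightarrow> real \<Rightarrow> real \<Rightarrow> nat \<Rightarrow> real" where
  "gap_weight c t q n = (1/2)^n * (if c n < t then 1 else if c n = t then q else 0)"

lemma summable_gap_weight:
  assumes "0 \<le> q" "q \<le> 1"
  shows "summable (gap_weight c t q)"
proof (rule summable_comparison_test)
  show "\<exists>N. \<forall>n\<ge>N. norm (gap_weight c t q n) \<le> (1/2)^n"
    using assms by (auto simp: gap_weight_def abs_mult)
  show "summable (\<lambda>n. (1/2::real)^n)"
    by (rule summable_geometric) simp
qed

lemma gap_weight_mono:
  assumes "0 \<le> p" "p \<le> 1" "0 \<le> q" "q \<le> 1" and "s < t \<or> s = t \<and> p \<le> q"
  shows "gap_weight c s p n \<le> gap_weight c t q n"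
  using assms by (auto simp: gap_weight_def intro!: mult_left_mono)

lemma suminf_gap_weight_mono:
  assumes "0 \<le> p" "p \<le> 1" "0 \<le> q" "q \<le> 1" and "s < t \<or> s = t \<and> p \<le> q"
  shows "suminf (gap_weight c s p) \<le> suminf (gap_weight c t q)"
  by (intro suminf_le gap_weight_mono summable_gap_weight assms)

text \<open>No term decreases when the fraction grows from p to q, and the term at an index k with
  \<open>c k = t\<close> grows by \<open>(1/2)^k * (q - p)\<close>. Without such an index there
  would be no gap at t to move in.\<close>

lemma suminf_gap_weight_strict_mono:
  assumes "0 \<le> p" "p < q" "q \<le> 1" and "t \<in> range c"
  shows "suminf (gap_weight c t p) < suminf (gap_weight c t q)"
proof -
  obtain k where k: "c k = t"
    using assms by auto
  let ?d = "\<lambda>n. gap_weight c t q n - gap_weight c t p n"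
  have sm: "summable (gap_weight c t p)" "summable (gap_weight c t q)"
    using assms by (auto intro!: summable_gap_weight)
  have "0 < suminf ?d"
  proof (rule suminf_pos2)
    show "summable ?d"
      using sm by (intro summable_diff)
    show "0 \<le> ?d n" for n
      using gap_weight_mono[of p q t t c n] assms by simp
    show "0 < ?d k"
      using k assms by (simp add: gap_weight_def)
  qed
  with sm show ?thesis
    by (simp add: suminf_diff[symmetric])
qed

lemma sum_multi_utility_strict:
  assumes "multi_utility X r I u" "finite I" "x \<in> X" "y \<in> X" "strict_in r x y"
  shows "(\<Sum>i\<in>I. u i x) < (\<Sum>i\<in>I. u i y)"
proof (rule sum_strict_mono_ex1)
  show "\<forall>i\<in>I. u i x \<le> u i y" "\<exists>i\<in>I. u i x < u i y"
    using assms unfolding multi_utility_def strict_in_def by (auto simp: not_le)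
qed fact

lemma strict_monotone_multi_utility_if_debreu_separable:
  assumes D: "debreu_separable X r" and fin: "finite I" and u: "multi_utility X r I u"
  shows "\<exists>v. strict_monotone_multi_utility X r I v"
proof -
  obtain D where D: "countable D"
      "\<And>x y. x \<in> X \<Longrightarrow> y \<in> X \<Longrightarrow> strict_in r x y \<Longrightarrow> \<exists>d\<in>D. (x, d) \<in> r \<and> (d, y) \<in> r"
      and DX: "D \<subseteq> X"
    using D unfolding debreu_separable_def by blast
  \<comment> \<open>The gaps of member i are to sit at the values of \<open>u i\<close> on D. If D
    is empty, \<open>c i\<close> is meaningless, but then no two points of X are strictly related;
    hence the next fact speaks only of d in D.\<close>
  define c where "c i = from_nat_into (u i ` D)" for i
  have c: "u i d \<in> range (c i)" if "d \<in> D" for i d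
  proof -
    have "range (c i) = u i ` D"
      unfolding c_def using that D(1) by (intro range_from_nat_into) auto
    with that show ?thesis by blast
  qed
  define s where "s x = (\<Sum>i\<in>I. u i x)" for x
  \<comment> \<open>The sum s serves as position inside a gap, so it is squeezed increasingly into
    the unit interval: \<open>arctan\<close> stays within pi/2 of 0, and pi < 4.\<close>
  define \<sigma> where "\<sigma> x = arctan (s x) / 4 + 1/2" for x
  have \<sigma>: "0 \<le> \<sigma> x" "\<sigma> x \<le> 1" for x
    using arctan_bounded[of "s x"] pi_less_4 by (auto simp: \<sigma>_def field_simps)
  have \<sigma>_mono: "\<sigma> x \<le> \<sigma> y" if "\<And>i. i \<in> I \<Longrightarrow> u i x \<le> u i y" for x y
    using sum_mono[of I "\<lambda>i. u i x" "\<lambda>i. u i y"] that by (simp add: \<sigma>_def s_def arctan_le_iff)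
  have \<sigma>_strict: "\<sigma> x < \<sigma> y" if "x \<in> X" "y \<in> X" "strict_in r x y" for x y
    using sum_multi_utility_strict[OF u fin that] by (simp add: \<sigma>_def s_def arctan_less_iff)
  have u_iff: "(x, y) \<in> r \<longleftrightarrow> (\<forall>i\<in>I. u i x \<le> u i y)" if "x \<in> X" "y \<in> X" for x y
    using u that unfolding multi_utility_def by blast
  \<comment> \<open>Keeping \<open>u i x\<close> as a summand preserves strict inequalities of
    \<open>u i\<close> between values where no gap is opened.\<close>
  define v where "v i x = u i x + suminf (gap_weight (c i) (u i x) (\<sigma> x))" for i x
  have v_less: "v i x < v i y" if "u i x < u i y" for i x y
    unfolding v_def using that by (intro add_less_le_mono suminf_gap_weight_mono \<sigma>) auto
  have v_le: "v i x \<le> v i y" if "x \<in> X" "y \<in> X" "(x, y) \<in> r" "i \<in> I" for i x y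
    unfolding v_def using that \<sigma>_mono[of x y] u_iff[of x y]
    by (intro add_mono suminf_gap_weight_mono \<sigma>) (auto simp: le_less)
  have v_strict: "v i x < v i y" if "x \<in> X" "y \<in> X" "strict_in r x y" "i \<in> I" for i x y
  proof (cases "u i x < u i y")
    case True
    then show ?thesis by (rule v_less)
  next
    case False
    obtain d where d: "d \<in> D" "(x, d) \<in> r" "(d, y) \<in> r"
      using D(2)[OF \<open>x \<in> X\<close> \<open>y \<in> X\<close> \<open>strict_in r x y\<close>] by blast
    then have "u i x \<le> u i d" "u i d \<le> u i y"
      using u_iff[of x d] u_iff[of d y] that DX by auto
    \<comment> \<open>The separating d is squeezed between x and y, so the common value is one with
      a gap, and \<open>\<sigma>\<close> decides inside it.\<close>
    with False have eq: "u i x = u i d" "u i y = u i d" by auto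
    show ?thesis
      unfolding v_def eq
      using suminf_gap_weight_strict_mono[OF \<sigma>(1) \<sigma>_strict \<sigma>(2) c] that d by simp
  qed
  \<comment> \<open>If x is not below y, some \<open>u i y < u i x\<close>, and
    \<open>v_less\<close> carries this over to \<open>v i\<close>.\<close>
  have "(x, y) \<in> r \<longleftrightarrow> (\<forall>i\<in>I. v i x \<le> v i y)" if "x \<in> X" "y \<in> X" for x y
    using that v_le v_less u_iff by (meson not_le)
  with v_le v_strict have "strict_monotone_multi_utility X r I v"
    unfolding strict_monotone_multi_utility_def multi_utility_def strict_monotone_def by blast
  then show ?thesis by blast
qed

section \<open>The product order on the plane\<close>

definition plane_order :: "((real \<times> real) \<times> (real \<times> real)) set" where
  "plane_order = {(p, q). fst p \<le> fst q \<and> snd p \<le> snd q}"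

lemma partial_order_plane_order: "partial_order_on UNIV plane_order"
  by (auto simp: plane_order_def partial_order_on_def preorder_on_def refl_on_def trans_def antisym_def)

lemma multi_utility_coordinates:
  "multi_utility UNIV plane_order {0, 1::nat} (\<lambda>i. if i = 0 then fst else snd)"
  by (auto simp: multi_utility_def plane_order_def)

lemma strict_monotone_positive_combination:
  assumes "a > 0" "b > 0"
  shows "strict_monotone UNIV plane_order (\<lambda>p. a * fst p + b * snd p)"
proof -
  have "a * x + b * y < a * x' + b * y'"
    if "x \<le> x'" "y \<le> y'" "x < x' \<or> y < y'" for x y x' y' :: real
    using that(3)
  proof
    assume "x < x'"
    then show ?thesis using assms that by (intro add_less_le_mono) auto
  next
    assume "y < y'"
    then show ?thesis using assms that by (intro add_le_less_mono) auto
  qed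
  then show ?thesis
    using assms
    by (auto simp: strict_monotone_def strict_in_def plane_order_def not_le intro!: add_mono)
qed

text \<open>This recovers a coordinate inequality from the combinations in which that coordinate has
  an arbitrarily large coefficient.\<close>

lemma nonpos_if_multiples_bounded:
  fixes a b :: real
  assumes "\<And>n. real (Suc n) * a \<le> b"
  shows "a \<le> 0"
proof (rule ccontr)
  assume "\<not> a \<le> 0"
  then obtain n where "b < real n * a"
    using reals_Archimedean3[of a] by auto
  also have "\<dots> \<le> real (Suc n) * a"
    using \<open>\<not> a \<le> 0\<close> by (intro mult_right_mono) auto
  finally show False using assms[of n] by simp
qed

text \<open>The family is a set of functions indexed by itself, which fits the index type used for
  minimality. \<open>Suc n\<close> keeps the coefficients positive, and the factors 1 give both
  halves the shape of \<open>strict_monotone_positive_combination\<close>.\<close>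

definition plane_combinations :: "(real \<times> real \<Rightarrow> real) set" where
  "plane_combinations =
     range (\<lambda>n p. real (Suc n) * fst p + 1 * snd p) \<union> range (\<lambda>n p. 1 * fst p + real (Suc n) * snd p)"

lemma plane_combinations_strict_monotone_multi_utility:
  "strict_monotone_multi_utility UNIV plane_order plane_combinations (\<lambda>f. f)"
proof -
  have mono: "strict_monotone UNIV plane_order f" if "f \<in> plane_combinations" for f
    using that unfolding plane_combinations_def
    by (elim UnE rangeE, simp_all only:) (rule strict_monotone_positive_combination; simp)+
  have "(p, q) \<in> plane_order" if le: "\<forall>f\<in>plane_combinations. f p \<le> f q" for p q
  proof -
    have "real (Suc n) * (fst p - fst q) \<le> snd q - snd p" for n
      using bspec[OF le, of "\<lambda>p. real (Suc n) * fst p + 1 * snd p"]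
      by (simp add: plane_combinations_def algebra_simps)
    moreover have "real (Suc n) * (snd p - snd q) \<le> fst q - fst p" for n
      using bspec[OF le, of "\<lambda>p. 1 * fst p + real (Suc n) * snd p"]
      by (simp add: plane_combinations_def algebra_simps)
    ultimately show ?thesis
      using nonpos_if_multiples_bounded unfolding plane_order_def by fastforce
  qed
  with mono show ?thesis
    unfolding strict_monotone_multi_utility_def multi_utility_def strict_monotone_def by blast
qed

lemma plane_combinations_eqpoll_nat: "plane_combinations \<approx> (UNIV :: nat set)"
proof -
  let ?f = "\<lambda>n (p :: real \<times> real). real (Suc n) * fst p + 1 * snd p"
  \<comment> \<open>The value at (1, 0) is \<open>Suc n\<close>.\<close>
  have "inj ?f"
    by (rule injI) (drule fun_cong[of _ _ "(1, 0)"], simp)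
  then have "infinite plane_combinations"
    by (auto simp: plane_combinations_def dest: range_inj_infinite)
  moreover have "countable plane_combinations"
    by (simp add: plane_combinations_def)
  ultimately show ?thesis
    using bij_betw_from_nat_into eqpoll_def eqpoll_sym by blast
qed

lemma infinite_strict_monotone_multi_utility_plane:
  assumes w: "strict_monotone_multi_utility UNIV plane_order J w"
  shows "infinite J"
proof
  assume fin: "finite J"
  have ex: "\<exists>q. q \<in> \<rat> \<and> w j (x, 0) < q \<and> q < w j (x, 1)" if "j \<in> J" for x j
  proof -
    have "strict_in plane_order (x, 0) (x, 1)"
      by (simp add: strict_in_def plane_order_def)
    with w that have "w j (x, 0) < w j (x, 1)"
      unfolding strict_monotone_multi_utility_def strict_monotone_def by blast
    then show ?thesis using Rats_dense_in_real by blast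
  qed
  \<comment> \<open>Outside J the chosen value is unconstrained, so \<open>q x\<close> is compared
    only after restriction to J.\<close>
  define q where "q x j = (SOME q. q \<in> \<rat> \<and> w j (x, 0) < q \<and> q < w j (x, 1))" for x j
  have q: "q x j \<in> \<rat> \<and> w j (x, 0) < q x j \<and> q x j < w j (x, 1)" if "j \<in> J" for x j
    unfolding q_def by (rule someI_ex) (rule ex[OF that])
  have neq: "restrict (q x) J \<noteq> restrict (q x') J" if "x < x'" for x x'
  proof
    assume eq: "restrict (q x) J = restrict (q x') J"
    \<comment> \<open>A member j witnessing this gives
      \<open>q x j < w j (x, 1) < w j (x', 0) < q x' j\<close>.\<close>
    have "((x', 0), (x, 1)) \<notin> plane_order"
      using that by (simp add: plane_order_def)
    then obtain j where j: "j \<in> J" "w j (x, 1) < w j (x', 0)"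
      using w unfolding strict_monotone_multi_utility_def multi_utility_def by (auto simp: not_le)
    have "q x j = q x' j"
      using fun_cong[OF eq, of j] j by simp
    with q[OF j(1), of x] q[OF j(1), of x'] j(2) show False by linarith
  qed
  have "inj (\<lambda>x. restrict (q x) J)"
    by (rule linorder_injI) (rule neq)
  moreover have "range (\<lambda>x. restrict (q x) J) \<subseteq> PiE J (\<lambda>_. \<rat>)"
    using q by auto
  moreover have "countable (PiE J (\<lambda>_. \<rat> :: real set))"
    using fin by (intro countable_PiE countable_rat)
  ultimately have "countable (UNIV :: real set)"
    by (meson countable_image_inj_on countable_subset)
  with uncountable_UNIV_real show False by simp
qed

lemma plane_order_smallest_countably_infinite:
  "smallest_strict_monotone_multi_utility_countably_infinite UNIV plane_order"
proof -
  have "plane_combinations \<lesssim> J" if "strict_monotone_multi_utility UNIV plane_order J w"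
    for J :: "(real \<times> real \<Rightarrow> real) set" and w
    using infinite_strict_monotone_multi_utility_plane[OF that] plane_combinations_eqpoll_nat
    by (meson infinite_le_lepoll lepoll_trans1)
  then show ?thesis
    unfolding smallest_strict_monotone_multi_utility_countably_infinite_def
    using plane_combinations_strict_monotone_multi_utility plane_combinations_eqpoll_nat by blast
qed

theorem theorem3:
  "(\<forall>(X :: 'a set) r (I :: 'i set).
      preorder_on X r \<and> debreu_separable X r \<and> finite I \<longrightarrow>
      ((\<exists>u. multi_utility X r I u) \<longleftrightarrow> (\<exists>v. strict_monotone_multi_utility X r I v)))
   \<and> (\<exists>(X :: (real \<times> real) set) r.
        partial_order_on X r \<and>
        (\<exists>(I :: nat set) u. finite I \<and> multi_utility X r I u) \<and>
        smallest_strict_monotone_multi_utility_countably_infinite X r)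
   \<and> (\<exists>(X :: (real \<times> real) set) r.
        partial_order_on X r \<and>
        (\<exists>(I :: nat set) u. card I = 2 \<and> multi_utility X r I u) \<and>
        smallest_strict_monotone_multi_utility_countably_infinite X r)"
proof (intro conjI allI impI)
  fix X :: "'a set" and r and I :: "'i set"
  assume "preorder_on X r \<and> debreu_separable X r \<and> finite I"
  then show "(\<exists>u. multi_utility X r I u) \<longleftrightarrow> (\<exists>v. strict_monotone_multi_utility X r I v)"
    using strict_monotone_multi_utility_if_debreu_separable
    unfolding strict_monotone_multi_utility_def by blast
next
  have "finite {0, 1::nat}" "card {0, 1::nat} = 2" by simp_all
  note plane = this multi_utility_coordinates partial_order_plane_order
    plane_order_smallest_countably_infinite
  show "\<exists>(X :: (real \<times> real) set) r. partial_order_on X r \<and>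
        (\<exists>(I :: nat set) u. finite I \<and> multi_utility X r I u) \<and>
        smallest_strict_monotone_multi_utility_countably_infinite X r"
    using plane by blast
  show "\<exists>(X :: (real \<times> real) set) r. partial_order_on X r \<and>
        (\<exists>(I :: nat set) u. card I = 2 \<and> multi_utility X r I u) \<and>
        smallest_strict_monotone_multi_utility_countably_infinite X r"
    using plane by blast
qed

end
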